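(* Let $k$ be a field, $\mathcal A$ a (non-commutative) algebra over $k$, and let $q,r\in k$ be invertible with $q\neq 1$ and $r\neq 1$. (a) Let $(U_1,U_2)$ be a quantum matrix pair of type I. Then $(q^{-nm/2}U_1^nU_2^m,\; q^{-st/2}U_1^sU_2^t)$ is a quantum matrix pair of type I, with $q$ replaced with $q^{nt-ms}$, for all $n,m,s,t\in\mathbf Z$. (b) Let $(U_1,U_2)$ be a quantum matrix pair of type II. Then $(U_1^nU_2^m,\; U_1^sU_2^t)$ is a quantum matrix pair of type II, with $q$ replaced with $q^{nt-ms}$, for all $n,m,s,t\in\mathbf Z$. (c) Let $(U_1,U_2)$ be a quantum matrix pair of type III. Then $(U_1^n,U_2^n)$ is a quantum matrix pair of type III, with $q$ replaced with $q^{n^2}$ and $r$ replaced with $r^n$, for all $n\in\mathbf Z$.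
   Context: The matrices are upper triangular, $U_i=\begin{pmatrix}\alpha_i&\beta_i\\0&\gamma_i\end{pmatrix}$, $i=1,2$, with entries in $\mathcal A$ and with $\alpha_i,\gamma_i$ invertible, so that $U_i$ is invertible. Consider the following relations, where those with index $i$ are required for $i=1,2$, and $q,r\in k$ are invertible parameters with $q\neq1$, $r\neq 1$: (ID1) $\alpha_i\gamma_i=\gamma_i\alpha_i=1$. (ID2) $\alpha_i\gamma_i=\gamma_i\alpha_i$. (IND1) $\alpha_i\beta_i=\beta_i\gamma_i$. (IND2) $\alpha_i\beta_i=r\beta_i\gamma_i$. (MD1) $\alpha_1\alpha_2=q\alpha_2\alpha_1$. (MD2) $\alpha_1\alpha_2=q\alpha_2\alpha_1$, $\alpha_1\gamma_2=q^{-1}\gamma_2\alpha_1$, $\alpha_2\gamma_1=q\gamma_1\alpha_2$, $\gamma_1\gamma_2=q\gamma_2\gamma_1$. (MND) $\alpha_1\beta_2=q\beta_2\gamma_1$, $\beta_1\gamma_2=q\alpha_2\beta_1$. The pair $(U_1,U_2)$ is a quantum matrix pair of type I if (ID1), (IND1), (MD1), (MND) hold; of type II if (ID2), (IND1), (MD2), (MND) hold; and of type III (a restricted quantum matrix pair) if (ID2), (IND2), (MD2), (MND) hold. In all three types $U_1U_2=qU_2U_1$. *)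

theory Defs
  imports "HOL-Analysis.Analysis"
begin

text \<open>
  A unital associative algebra over a field \<open>'k\<close>, not assumed commutative; the scalar
  action is an explicit parameter. The algebra class \<open>real_algebra_1\<close> of the
  distribution is restricted to real scalars.
\<close>

locale k_algebra = vector_space smul
  for smul :: "'k::field \<Rightarrow> 'a::ring_1 \<Rightarrow> 'a" +
  assumes smul_mult_left: "smul c x * y = smul c (x * y)"
    and smul_mult_right: "x * smul c y = smul c (x * y)"

definition two_sided_unit :: "'a::ring_1 \<Rightarrow> bool" where
  "two_sided_unit x \<longleftrightarrow> (\<exists>y. x * y = 1 \<and> y * x = 1)"

text \<open>
  Matrices multiply by \<open>(**)\<close>; the operations \<open>(*)\<close> and \<open>(^)\<close> on vectors are componentwise,
  so powers of matrices need their own definition.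
\<close>

definition matrix_powi :: "'a::ring_1^2^2 \<Rightarrow> int \<Rightarrow> 'a^2^2" where
  "matrix_powi U n =
    (if n \<ge> 0 then (((**) U) ^^ nat n) (mat 1)
     else (((**) (matrix_inv U)) ^^ nat (- n)) (mat 1))"

text \<open>
  \<open>half_powi q h e\<close> is the power of \<open>q\<close> with exponent \<open>e / 2\<close>, where \<open>h\<close> is a chosen
  square root of \<open>q\<close>. For even \<open>e\<close> no square root is involved.
\<close>

definition half_powi :: "'k::field \<Rightarrow> 'k \<Rightarrow> int \<Rightarrow> 'k" where
  "half_powi q h e = (if even e then q powi (e div 2) else h powi e)"

abbreviation alpha :: "'a^2^2 \<Rightarrow> 'a" where "alpha U \<equiv> U $ 1 $ 1"
abbreviation beta :: "'a^2^2 \<Rightarrow> 'a" where "beta U \<equiv> U $ 1 $ 2"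
abbreviation gamma :: "'a^2^2 \<Rightarrow> 'a" where "gamma U \<equiv> U $ 2 $ 2"

definition upper_triangular_unit :: "'a::ring_1^2^2 \<Rightarrow> bool" where
  "upper_triangular_unit U \<longleftrightarrow>
    U $ 2 $ 1 = 0 \<and> two_sided_unit (alpha U) \<and> two_sided_unit (gamma U)"

definition ID1 :: "'a::ring_1^2^2 \<Rightarrow> bool" where
  "ID1 U \<longleftrightarrow> alpha U * gamma U = 1 \<and> gamma U * alpha U = 1"

definition ID2 :: "'a::ring_1^2^2 \<Rightarrow> bool" where
  "ID2 U \<longleftrightarrow> alpha U * gamma U = gamma U * alpha U"

definition IND1 :: "'a::ring_1^2^2 \<Rightarrow> bool" where
  "IND1 U \<longleftrightarrow> alpha U * beta U = beta U * gamma U"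

definition IND2 :: "('k \<Rightarrow> 'a \<Rightarrow> 'a) \<Rightarrow> 'k \<Rightarrow> 'a::ring_1^2^2 \<Rightarrow> bool" where
  "IND2 smul r U \<longleftrightarrow> alpha U * beta U = smul r (beta U * gamma U)"

definition MD1 :: "('k \<Rightarrow> 'a \<Rightarrow> 'a) \<Rightarrow> 'k \<Rightarrow> 'a::ring_1^2^2 \<Rightarrow> 'a^2^2 \<Rightarrow> bool" where
  "MD1 smul q U\<^sub>1 U\<^sub>2 \<longleftrightarrow> alpha U\<^sub>1 * alpha U\<^sub>2 = smul q (alpha U\<^sub>2 * alpha U\<^sub>1)"

definition MD2 :: "('k::field \<Rightarrow> 'a \<Rightarrow> 'a) \<Rightarrow> 'k \<Rightarrow> 'a::ring_1^2^2 \<Rightarrow> 'a^2^2 \<Rightarrow> bool" where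
  "MD2 smul q U\<^sub>1 U\<^sub>2 \<longleftrightarrow>
    alpha U\<^sub>1 * alpha U\<^sub>2 = smul q (alpha U\<^sub>2 * alpha U\<^sub>1) \<and>
    alpha U\<^sub>1 * gamma U\<^sub>2 = smul (inverse q) (gamma U\<^sub>2 * alpha U\<^sub>1) \<and>
    alpha U\<^sub>2 * gamma U\<^sub>1 = smul q (gamma U\<^sub>1 * alpha U\<^sub>2) \<and>
    gamma U\<^sub>1 * gamma U\<^sub>2 = smul q (gamma U\<^sub>2 * gamma U\<^sub>1)"

definition MND :: "('k \<Rightarrow> 'a \<Rightarrow> 'a) \<Rightarrow> 'k \<Rightarrow> 'a::ring_1^2^2 \<Rightarrow> 'a^2^2 \<Rightarrow> bool" where
  "MND smul q U\<^sub>1 U\<^sub>2 \<longleftrightarrow>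
    alpha U\<^sub>1 * beta U\<^sub>2 = smul q (beta U\<^sub>2 * gamma U\<^sub>1) \<and>
    beta U\<^sub>1 * gamma U\<^sub>2 = smul q (alpha U\<^sub>2 * beta U\<^sub>1)"

text \<open>
  The parameters are deliberately not required to differ from 1 here: a pair of products of
  powers satisfies the relations for a power of \<open>q\<close> (and of \<open>r\<close>), which may be equal to 1.
\<close>

definition quantum_pair_I :: "('k::field \<Rightarrow> 'a \<Rightarrow> 'a) \<Rightarrow> 'k \<Rightarrow> 'a::ring_1^2^2 \<Rightarrow> 'a^2^2 \<Rightarrow> bool" where
  "quantum_pair_I smul q U\<^sub>1 U\<^sub>2 \<longleftrightarrow>
    upper_triangular_unit U\<^sub>1 \<and> upper_triangular_unit U\<^sub>2 \<and>
    ID1 U\<^sub>1 \<and> ID1 U\<^sub>2 \<and> IND1 U\<^sub>1 \<and> IND1 U\<^sub>2 \<and>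
    MD1 smul q U\<^sub>1 U\<^sub>2 \<and> MND smul q U\<^sub>1 U\<^sub>2"

definition quantum_pair_II :: "('k::field \<Rightarrow> 'a \<Rightarrow> 'a) \<Rightarrow> 'k \<Rightarrow> 'a::ring_1^2^2 \<Rightarrow> 'a^2^2 \<Rightarrow> bool" where
  "quantum_pair_II smul q U\<^sub>1 U\<^sub>2 \<longleftrightarrow>
    upper_triangular_unit U\<^sub>1 \<and> upper_triangular_unit U\<^sub>2 \<and>
    ID2 U\<^sub>1 \<and> ID2 U\<^sub>2 \<and> IND1 U\<^sub>1 \<and> IND1 U\<^sub>2 \<and>
    MD2 smul q U\<^sub>1 U\<^sub>2 \<and> MND smul q U\<^sub>1 U\<^sub>2"

definition quantum_pair_III ::
  "('k::field \<Rightarrow> 'a \<Rightarrow> 'a) \<Rightarrow> 'k \<Rightarrow> 'k \<Rightarrow> 'a::ring_1^2^2 \<Rightarrow> 'a^2^2 \<Rightarrow> bool" where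
  "quantum_pair_III smul q r U\<^sub>1 U\<^sub>2 \<longleftrightarrow>
    upper_triangular_unit U\<^sub>1 \<and> upper_triangular_unit U\<^sub>2 \<and>
    ID2 U\<^sub>1 \<and> ID2 U\<^sub>2 \<and> IND2 smul r U\<^sub>1 \<and> IND2 smul r U\<^sub>2 \<and>
    MD2 smul q U\<^sub>1 U\<^sub>2 \<and> MND smul q U\<^sub>1 U\<^sub>2"

end

theory Submission
  imports Defs
begin

text \<open>
  For types II and III all relations are instances of a single one. Say that \<open>X\<close> commutes
  with \<open>Y\<close> up to \<open>(a, c)\<close> if

    \<^item> \<open>\<alpha>\<^sub>X \<alpha>\<^sub>Y = a \<alpha>\<^sub>Y \<alpha>\<^sub>X\<close>, \<open>\<alpha>\<^sub>X \<gamma>\<^sub>Y = a\<^sup>-\<^sup>1 \<gamma>\<^sub>Y \<alpha>\<^sub>X\<close>, \<open>\<gamma>\<^sub>X \<gamma>\<^sub>Y = a \<gamma>\<^sub>Y \<gamma>\<^sub>X\<close>,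
    \<^item> \<open>\<alpha>\<^sub>X \<beta>\<^sub>Y = a c \<beta>\<^sub>Y \<gamma>\<^sub>X\<close>.

  The internal relations of a pair of type III say that each \<open>U\<^sub>i\<close> commutes with itself up to
  \<open>(1, r)\<close>; the mutual ones say that \<open>U\<^sub>1\<close> commutes with \<open>U\<^sub>2\<close> up to \<open>(q, 1)\<close> and \<open>U\<^sub>2\<close> with
  \<open>U\<^sub>1\<close> up to \<open>(q\<^sup>-\<^sup>1, 1)\<close>. Type II is the case \<open>r = 1\<close>.

  The point of this relation is that it behaves like a bicharacter on invertible upper
  triangular matrices: \<open>a\<close> is multiplicative in \<open>X\<close> and in \<open>Y\<close>, whereas \<open>c\<close> is multiplicative
  in \<open>X\<close> and constant in \<open>Y\<close> (\<open>twisted_commute_mult_left\<close>, \<open>twisted_commute_mult_right\<close> and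
  their versions for inverses). All exponents can therefore be read off. For \<open>c = 1\<close> the
  monomials \<open>U\<^sub>1\<^sup>n U\<^sub>2\<^sup>m\<close> and \<open>U\<^sub>1\<^sup>s U\<^sub>2\<^sup>t\<close> commute up to \<open>q\<close> to the power \<open>n t - m s\<close>; this
  determinant vanishes for a monomial against itself and changes sign when the two are
  exchanged, which is what type II demands. If \<open>r \<noteq> 1\<close>, the constant \<open>c\<close> of the right factor
  has to be the same for all its factors, so the argument covers powers of a single \<open>U\<^sub>i\<close> but not
  products of \<open>U\<^sub>1\<close> and \<open>U\<^sub>2\<close>: to the right of \<open>U\<^sub>1\<close> they carry \<open>r\<close> and \<open>1\<close>.

  Type I is type II with \<open>\<gamma>\<^sub>i = \<alpha>\<^sub>i\<^sup>-\<^sup>1\<close>, because the missing relations then follow by inverting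
  \<open>\<alpha>\<^sub>1 \<alpha>\<^sub>2 = q \<alpha>\<^sub>2 \<alpha>\<^sub>1\<close>. The diagonal entries of \<open>U\<^sub>1\<^sup>n U\<^sub>2\<^sup>m\<close> have product \<open>q\<^sup>n\<^sup>m\<close>, and the
  scalar with square \<open>q\<^sup>-\<^sup>n\<^sup>m\<close> restores the product 1 without affecting the other relations,
  which are homogeneous.
\<close>


section \<open>Invertible upper triangular matrices\<close>

lemma matrix_mult_2_entries:
  fixes X Y :: "'a::ring_1^2^2"
  shows "(X ** Y) $ i $ j = X $ i $ 1 * Y $ 1 $ j + X $ i $ 2 * Y $ 2 $ j"
  by (simp add: matrix_matrix_mult_def sum_2)

lemma matrix_2_eqI:
  fixes X Y :: "'a^2^2"
  assumes "X $ 1 $ 1 = Y $ 1 $ 1" "X $ 1 $ 2 = Y $ 1 $ 2" "X $ 2 $ 1 = Y $ 2 $ 1" "X $ 2 $ 2 = Y $ 2 $ 2"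
  shows "X = Y"
  using assms by (simp add: vec_eq_iff forall_2)

lemma two_sided_unit_1: "two_sided_unit 1"
  unfolding two_sided_unit_def by (intro exI[of _ 1]) simp

lemma two_sided_unit_mult:
  assumes "two_sided_unit x" "two_sided_unit y"
  shows "two_sided_unit (x * y)"
proof -
  obtain x' y' where inv: "x * x' = 1" "x' * x = 1" "y * y' = 1" "y' * y = 1"
    using assms unfolding two_sided_unit_def by blast
  have "x * y * (y' * x') = x * (y * y') * x'" "y' * x' * (x * y) = y' * (x' * x) * y"
    by (simp_all only: mult.assoc)
  then show ?thesis
    unfolding two_sided_unit_def using inv by (intro exI[of _ "y' * x'"]) simp
qed

lemma upper_triangular_unit_mat_1: "upper_triangular_unit (mat 1)"
  by (simp add: upper_triangular_unit_def mat_def two_sided_unit_1)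

lemma upper_triangular_unit_mult:
  assumes "upper_triangular_unit X" "upper_triangular_unit Y"
  shows "upper_triangular_unit (X ** Y)"
  using assms
  by (simp add: upper_triangular_unit_def matrix_mult_2_entries two_sided_unit_mult)

text \<open>
  The constant \<open>matrix_inv\<close> is defined by choice and has to be identified with an explicit
  matrix before its entries can be computed.
\<close>

lemma matrix_inv_unique_ring:
  fixes X Y :: "'a::ring_1^'n^'n"
  assumes "X ** Y = mat 1" "Y ** X = mat 1"
  shows "matrix_inv X = Y"
proof -
  have "X ** matrix_inv X = mat 1"
    unfolding matrix_inv_def by (rule someI2[of _ Y]) (use assms in auto)
  then have "Y = Y ** (X ** matrix_inv X)" by simp
  also have "\<dots> = matrix_inv X" by (simp add: matrix_mul_assoc assms(2))
  finally show ?thesis ..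
qed

text \<open>
  The inverse is \<open>(\<alpha>\<^sup>-\<^sup>1, - \<alpha>\<^sup>-\<^sup>1 \<beta> \<gamma>\<^sup>-\<^sup>1; 0, \<gamma>\<^sup>-\<^sup>1)\<close>, as one checks by multiplying out.
\<close>

lemma upper_triangular_unit_matrix_inv:
  assumes "upper_triangular_unit X"
  shows "upper_triangular_unit (matrix_inv X)"
    and "alpha X * alpha (matrix_inv X) = 1" "alpha (matrix_inv X) * alpha X = 1"
    and "gamma X * gamma (matrix_inv X) = 1" "gamma (matrix_inv X) * gamma X = 1"
    and "beta (matrix_inv X) = - (alpha (matrix_inv X) * beta X * gamma (matrix_inv X))"
proof -
  obtain a g where inv: "alpha X * a = 1" "a * alpha X = 1" "gamma X * g = 1" "g * gamma X = 1"
    and low: "X $ 2 $ 1 = 0"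
    using assms unfolding upper_triangular_unit_def two_sided_unit_def by blast
  define Y :: "'a^2^2" where
    "Y = (\<chi> i j. if i = 1 then (if j = 1 then a else - (a * beta X * g)) else (if j = 1 then 0 else g))"
  have Y: "alpha Y = a" "beta Y = - (a * beta X * g)" "Y $ 2 $ 1 = 0" "gamma Y = g"
    by (simp_all add: Y_def)
  have "alpha X * (a * beta X * g) = (alpha X * a) * beta X * g"
    by (simp only: mult.assoc)
  then have "X ** Y = mat 1"
    by (intro matrix_2_eqI) (simp_all add: matrix_mult_2_entries Y low inv mat_def)
  moreover have "Y ** X = mat 1"
    by (intro matrix_2_eqI) (simp_all add: matrix_mult_2_entries Y low inv mat_def mult.assoc)
  ultimately have "matrix_inv X = Y"
    by (rule matrix_inv_unique_ring)
  then show "upper_triangular_unit (matrix_inv X)"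
    and "alpha X * alpha (matrix_inv X) = 1" "alpha (matrix_inv X) * alpha X = 1"
    and "gamma X * gamma (matrix_inv X) = 1" "gamma (matrix_inv X) * gamma X = 1"
    and "beta (matrix_inv X) = - (alpha (matrix_inv X) * beta X * gamma (matrix_inv X))"
    using inv by (auto simp: Y upper_triangular_unit_def two_sided_unit_def)
qed

text \<open>
  Positive powers are iterated products with \<open>U\<close> and negative ones with its inverse, so a
  property that is preserved by both factors reaches every integer power.
\<close>

lemma matrix_powi_induct:
  assumes "P 0 (mat 1)"
    and "\<And>k Y. P k Y \<Longrightarrow> P (k + 1) (U ** Y)"
    and "\<And>k Y. P k Y \<Longrightarrow> P (k - 1) (matrix_inv U ** Y)"
  shows "P n (matrix_powi U n)"
proof -
  have pos: "P (int k) (((**) U ^^ k) (mat 1))" for k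
  proof (induction k)
    case (Suc k)
    then show ?case using assms(2)[of "int k"] by (simp add: add.commute)
  qed (use assms(1) in simp)
  have neg: "P (- int k) (((**) (matrix_inv U) ^^ k) (mat 1))" for k
  proof (induction k)
    case (Suc k)
    moreover have "- int (Suc k) = - int k - 1" by simp
    ultimately show ?case using assms(3)[of "- int k"] by (simp only: funpow.simps o_apply)
  qed (use assms(1) in simp)
  show ?thesis
    using pos[of "nat n"] neg[of "nat (- n)"] by (cases "n \<ge> 0") (simp_all add: matrix_powi_def)
qed

lemma upper_triangular_unit_matrix_powi:
  assumes "upper_triangular_unit U"
  shows "upper_triangular_unit (matrix_powi U n)"
  by (rule matrix_powi_induct)
    (use assms in \<open>simp_all add: upper_triangular_unit_mat_1 upper_triangular_unit_mult
      upper_triangular_unit_matrix_inv(1)\<close>)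


section \<open>Twisted commutation of matrices\<close>

context k_algebra
begin

text \<open>
  The fourth equation carries \<open>a * c\<close> rather than an independent constant, because
  the ratio of the two constants, not the constant of this equation, is what all factors
  on the right have to share.
\<close>

definition twisted_commute :: "'k \<Rightarrow> 'k \<Rightarrow> 'a^2^2 \<Rightarrow> 'a^2^2 \<Rightarrow> bool" where
  "twisted_commute a c X Y \<longleftrightarrow>
    alpha X * alpha Y = smul a (alpha Y * alpha X) \<and>
    alpha X * gamma Y = smul (inverse a) (gamma Y * alpha X) \<and>
    gamma X * gamma Y = smul a (gamma Y * gamma X) \<and>
    alpha X * beta Y = smul (a * c) (beta Y * gamma X)"

text \<open>
  Each entry of the relation has the form \<open>x w = a w x'\<close>, where \<open>x'\<close> is again \<open>x\<close>, except that
  \<open>\<alpha>\<close> turns into \<open>\<gamma>\<close> when it passes \<open>\<beta>\<close>. The next lemmas compose and invert such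
  equations.
\<close>

lemma smul_mult_swap_left_mult:
  assumes "x * w = smul a (w * x')" "y * w = smul b (w * y')"
  shows "x * y * w = smul (a * b) (w * (x' * y'))"
proof -
  have "x * y * w = smul b ((x * w) * y')"
    by (simp add: mult.assoc assms(2) smul_mult_right)
  then show ?thesis by (simp add: assms(1) smul_mult_left mult.assoc mult.commute[of a])
qed

lemma smul_mult_swap_right_mult:
  assumes "w * x = smul a (x * w')" "w' * y = smul b (y * w'')"
  shows "w * (x * y) = smul (a * b) (x * y * w'')"
proof -
  have "w * (x * y) = smul a (x * (w' * y))"
    by (simp add: mult.assoc[symmetric] assms(1) smul_mult_left)
  then show ?thesis by (simp add: assms(2) smul_mult_right mult.assoc)
qed

lemma smul_mult_swap_left_inverse:
  assumes "x * w = smul a (w * y)" "a \<noteq> 0" "x' * x = 1" "y * y' = 1"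
  shows "x' * w = smul (inverse a) (w * y')"
proof -
  have "w * y' = x' * (x * w) * y'"
    by (simp add: mult.assoc[symmetric] assms(3))
  also have "\<dots> = smul a (x' * w * (y * y'))"
    by (simp only: assms(1) smul_mult_left smul_mult_right mult.assoc)
  finally show ?thesis by (simp add: assms(2,4))
qed

lemma smul_mult_swap_sym:
  assumes "x * y = smul a (y * x)" "a \<noteq> 0"
  shows "y * x = smul (inverse a) (x * y)"
  using assms by simp

lemma smul_mult_swap_right_inverse:
  assumes "w * x = smul a (x * w)" "a \<noteq> 0" "x * x' = 1" "x' * x = 1"
  shows "w * x' = smul (inverse a) (x' * w)"
proof -
  have "x' * w = smul a (w * x')"
    using smul_mult_swap_left_inverse[OF smul_mult_swap_sym[OF assms(1,2)]] assms by simp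
  then show ?thesis using assms(2) by simp
qed

lemma twisted_commute_mult_left:
  assumes "upper_triangular_unit X" "upper_triangular_unit Y"
    and "twisted_commute a c X Z" "twisted_commute b d Y Z"
  shows "twisted_commute (a * b) (c * d) (X ** Y) Z"
proof -
  have "alpha X * alpha Y * beta Z = smul ((a * c) * (b * d)) (beta Z * (gamma X * gamma Y))"
    using assms(3,4) by (intro smul_mult_swap_left_mult) (auto simp: twisted_commute_def)
  moreover have "(a * c) * (b * d) = (a * b) * (c * d)" by simp
  ultimately show ?thesis
    using assms by (auto simp: twisted_commute_def upper_triangular_unit_def matrix_mult_2_entries
        simp del: scale_scale intro!: smul_mult_swap_left_mult)
qed

text \<open>
  The entry \<open>\<beta>\<close> of the product is \<open>\<alpha>\<^sub>X \<beta>\<^sub>Y + \<beta>\<^sub>X \<gamma>\<^sub>Y\<close>. Passing \<open>\<alpha>\<^sub>Z\<close> through the two summands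
  gives the factors \<open>a (b c)\<close> and \<open>(a c) b\<close>. They agree because \<open>c\<close> is common to \<open>X\<close> and \<open>Y\<close>.
\<close>

lemma twisted_commute_mult_right:
  assumes "upper_triangular_unit X" "upper_triangular_unit Y"
    and "twisted_commute a c Z X" "twisted_commute b c Z Y"
  shows "twisted_commute (a * b) c Z (X ** Y)"
proof -
  have "alpha Z * (alpha X * beta Y) = smul (a * (b * c)) (alpha X * beta Y * gamma Z)"
    using assms(3,4) by (intro smul_mult_swap_right_mult) (auto simp: twisted_commute_def)
  moreover have "alpha Z * (beta X * gamma Y) = smul ((a * c) * b) (beta X * gamma Y * gamma Z)"
    using assms(3,4) by (intro smul_mult_swap_right_mult) (auto simp: twisted_commute_def)
  ultimately have "alpha Z * (alpha X * beta Y + beta X * gamma Y) =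
      smul (a * b * c) ((alpha X * beta Y + beta X * gamma Y) * gamma Z)"
    by (simp add: algebra_simps scale_right_distrib)
  then show ?thesis
    using assms by (auto simp: twisted_commute_def upper_triangular_unit_def matrix_mult_2_entries
        simp del: scale_scale intro!: smul_mult_swap_right_mult)
qed

lemma twisted_commute_mat_1_left: "twisted_commute 1 1 (mat 1) Z"
  by (simp add: twisted_commute_def mat_def)

lemma twisted_commute_mat_1_right: "twisted_commute 1 c Z (mat 1)"
  by (simp add: twisted_commute_def mat_def)

lemma twisted_commute_inv_left:
  assumes X: "upper_triangular_unit X" and "a \<noteq> 0" "c \<noteq> 0" and tc: "twisted_commute a c X Z"
  shows "twisted_commute (inverse a) (inverse c) (matrix_inv X) Z"
proof -
  note inv = upper_triangular_unit_matrix_inv[OF X]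
  have "alpha X * alpha Z = smul a (alpha Z * alpha X)"
    and "alpha X * gamma Z = smul (inverse a) (gamma Z * alpha X)"
    and "gamma X * gamma Z = smul a (gamma Z * gamma X)"
    and "alpha X * beta Z = smul (a * c) (beta Z * gamma X)"
    using tc by (simp_all add: twisted_commute_def)
  note entries = this[THEN smul_mult_swap_left_inverse]
  show ?thesis
    using entries(1)[OF _ inv(3,2)] entries(2)[OF _ inv(3,2)] entries(3)[OF _ inv(5,4)]
      entries(4)[OF _ inv(3,4)] \<open>a \<noteq> 0\<close> \<open>c \<noteq> 0\<close>
    by (simp add: twisted_commute_def)
qed

text \<open>
  In \<open>\<beta>\<close> of the inverse, \<open>- \<alpha>\<^sup>-\<^sup>1 \<beta> \<gamma>\<^sup>-\<^sup>1\<close>, the three factors contribute \<open>a\<^sup>-\<^sup>1\<close>, \<open>a c\<close> and \<open>a\<^sup>-\<^sup>1\<close>.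
  After passing \<open>\<beta>\<close>, \<open>\<alpha>\<^sub>Z\<close> has become \<open>\<gamma>\<^sub>Z\<close>, so the last contribution comes from the equation
  between \<open>\<gamma>\<^sub>Z\<close> and \<open>\<gamma>\<^sup>-\<^sup>1\<close>.
\<close>

lemma twisted_commute_inv_right:
  assumes X: "upper_triangular_unit X" and "a \<noteq> 0" and tc: "twisted_commute a c Z X"
  shows "twisted_commute (inverse a) c Z (matrix_inv X)"
proof -
  note inv = upper_triangular_unit_matrix_inv[OF X]
  have "alpha Z * alpha X = smul a (alpha X * alpha Z)"
    and "gamma Z * gamma X = smul a (gamma X * gamma Z)"
    and "alpha Z * gamma X = smul (inverse a) (gamma X * alpha Z)"
    using tc by (simp_all add: twisted_commute_def)
  note entries = this[THEN smul_mult_swap_right_inverse]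
  note \<alpha> = entries(1)[OF \<open>a \<noteq> 0\<close> inv(2,3)] and \<gamma> = entries(2)[OF \<open>a \<noteq> 0\<close> inv(4,5)]
    and \<alpha>\<gamma> = entries(3)[OF _ inv(4,5)]
  have "alpha Z * beta X = smul (a * c) (beta X * gamma Z)"
    using tc by (simp add: twisted_commute_def)
  then have "alpha Z * (alpha (matrix_inv X) * beta X * gamma (matrix_inv X)) =
      smul (inverse a * (a * c) * inverse a)
        (alpha (matrix_inv X) * beta X * gamma (matrix_inv X) * gamma Z)"
    by (intro smul_mult_swap_right_mult[OF smul_mult_swap_right_mult[OF \<alpha>] \<gamma>])
  then have "alpha Z * beta (matrix_inv X) = smul (inverse a * c) (beta (matrix_inv X) * gamma Z)"
    using \<open>a \<noteq> 0\<close> by (simp add: inv(6) mult.commute)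
  then show ?thesis
    using \<alpha> \<gamma> \<alpha>\<gamma> \<open>a \<noteq> 0\<close> by (simp add: twisted_commute_def)
qed

lemma twisted_commute_powi_left:
  assumes U: "upper_triangular_unit U" and "a \<noteq> 0" "c \<noteq> 0" and tc: "twisted_commute a c U Z"
  shows "twisted_commute (a powi n) (c powi n) (matrix_powi U n) Z"
proof -
  have "upper_triangular_unit (matrix_powi U n) \<and>
      twisted_commute (a powi n) (c powi n) (matrix_powi U n) Z"
  proof (rule matrix_powi_induct)
    fix k :: int and Y
    assume "upper_triangular_unit Y \<and> twisted_commute (a powi k) (c powi k) Y Z"
    then show "upper_triangular_unit (U ** Y) \<and>
        twisted_commute (a powi (k + 1)) (c powi (k + 1)) (U ** Y) Z"
      and "upper_triangular_unit (matrix_inv U ** Y) \<and>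
        twisted_commute (a powi (k - 1)) (c powi (k - 1)) (matrix_inv U ** Y) Z"
      using twisted_commute_mult_left[OF U _ tc, of Y "a powi k" "c powi k"]
        twisted_commute_mult_left[OF upper_triangular_unit_matrix_inv(1)[OF U] _
          twisted_commute_inv_left[OF assms], of Y "a powi k" "c powi k"]
        assms(2,3) U
      by (auto simp: upper_triangular_unit_mult upper_triangular_unit_matrix_inv(1)
          power_int_add power_int_diff divide_inverse mult.commute)
  qed (simp add: upper_triangular_unit_mat_1 twisted_commute_mat_1_left)
  then show ?thesis ..
qed

lemma twisted_commute_powi_right:
  assumes U: "upper_triangular_unit U" and "a \<noteq> 0" and tc: "twisted_commute a c Z U"
  shows "twisted_commute (a powi n) c Z (matrix_powi U n)"
proof -
  have "upper_triangular_unit (matrix_powi U n) \<and>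
      twisted_commute (a powi n) c Z (matrix_powi U n)"
  proof (rule matrix_powi_induct)
    fix k :: int and Y
    assume "upper_triangular_unit Y \<and> twisted_commute (a powi k) c Z Y"
    then show "upper_triangular_unit (U ** Y) \<and> twisted_commute (a powi (k + 1)) c Z (U ** Y)"
      and "upper_triangular_unit (matrix_inv U ** Y) \<and>
        twisted_commute (a powi (k - 1)) c Z (matrix_inv U ** Y)"
      using twisted_commute_mult_right[OF U _ tc, of Y "a powi k"]
        twisted_commute_mult_right[OF upper_triangular_unit_matrix_inv(1)[OF U] _
          twisted_commute_inv_right[OF assms], of Y "a powi k"]
        assms(2) U
      by (auto simp: upper_triangular_unit_mult upper_triangular_unit_matrix_inv(1)
          power_int_add power_int_diff divide_inverse mult.commute)
  qed (simp add: upper_triangular_unit_mat_1 twisted_commute_mat_1_right)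
  then show ?thesis ..
qed

lemma twisted_commute_powi_powi:
  assumes "upper_triangular_unit U" "upper_triangular_unit V" "a \<noteq> 0" "c \<noteq> 0"
    and "twisted_commute a c U V"
  shows "twisted_commute (a powi (n * m)) (c powi n) (matrix_powi U n) (matrix_powi V m)"
proof -
  have "twisted_commute (a powi n) (c powi n) (matrix_powi U n) V"
    using assms by (intro twisted_commute_powi_left)
  then show ?thesis
    using twisted_commute_powi_right[of V "a powi n"] assms by (simp add: power_int_mult)
qed

lemma twisted_commute_scale:
  assumes "twisted_commute a c X Y"
  shows "twisted_commute a c (map_matrix (smul k) X) (map_matrix (smul l) Y)"
  using assms
  by (auto simp: twisted_commute_def map_matrix_def smul_mult_left smul_mult_right ac_simps)


section \<open>Quantum matrix pairs as twisted commuting pairs\<close>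

text \<open>
  Commutation of \<open>U\<close> with \<open>V\<close> yields three equations of (MD2) and the first of (MND). The
  remaining ones, \<open>\<alpha>\<^sub>V \<gamma>\<^sub>U = q \<gamma>\<^sub>U \<alpha>\<^sub>V\<close> and \<open>\<beta>\<^sub>U \<gamma>\<^sub>V = q \<alpha>\<^sub>V \<beta>\<^sub>U\<close>, come from the opposite order,
  where the constant is \<open>q\<^sup>-\<^sup>1\<close>.
\<close>

lemma quantum_pair_III_iff:
  assumes "q \<noteq> 0"
  shows "quantum_pair_III smul q r U V \<longleftrightarrow>
    upper_triangular_unit U \<and> upper_triangular_unit V \<and>
    twisted_commute 1 r U U \<and> twisted_commute 1 r V V \<and>
    twisted_commute q 1 U V \<and> twisted_commute (inverse q) 1 V U"
proof -
  have swap: "y = smul (inverse q) x \<longleftrightarrow> x = smul q y" for x y :: 'a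
    using assms by auto
  show ?thesis
    by (auto simp: quantum_pair_III_def twisted_commute_def ID2_def IND2_def MD2_def MND_def
        swap assms)
qed

lemma quantum_pair_II_iff_III: "quantum_pair_II smul q U V \<longleftrightarrow> quantum_pair_III smul q 1 U V"
  by (simp add: quantum_pair_II_def quantum_pair_III_def IND1_def IND2_def)

text \<open>
  When \<open>\<gamma>\<close> is the inverse of \<open>\<alpha>\<close>, inverting one or both factors of
  \<open>\<alpha>\<^sub>U \<alpha>\<^sub>V = q \<alpha>\<^sub>V \<alpha>\<^sub>U\<close> turns it into the other three equations of (MD2).
\<close>

lemma quantum_pair_I_iff_II:
  assumes "q \<noteq> 0"
  shows "quantum_pair_I smul q U V \<longleftrightarrow> ID1 U \<and> ID1 V \<and> quantum_pair_II smul q U V"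
proof -
  have "MD2 smul q U V" if U: "ID1 U" and V: "ID1 V" and md: "MD1 smul q U V"
  proof -
    have 1: "alpha U * alpha V = smul q (alpha V * alpha U)"
      using md by (simp add: MD1_def)
    have 2: "alpha U * gamma V = smul (inverse q) (gamma V * alpha U)"
      using V by (intro smul_mult_swap_right_inverse[OF 1 assms]) (simp_all add: ID1_def)
    have 3: "alpha V * gamma U = smul (inverse (inverse q)) (gamma U * alpha V)"
      using U assms
      by (intro smul_mult_swap_right_inverse[OF smul_mult_swap_sym[OF 1 assms]])
        (simp_all add: ID1_def)
    have "gamma V * gamma U = smul (inverse q) (gamma U * gamma V)"
      using V smul_mult_swap_left_inverse[OF 3, of "gamma V" "gamma V"] assms
      by (simp add: ID1_def)
    then show ?thesis using 1 2 3 assms by (simp add: MD2_def)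
  qed
  then show ?thesis
    by (auto simp: quantum_pair_I_def quantum_pair_II_def ID1_def ID2_def MD1_def MD2_def)
qed

lemma quantum_pair_III_powi:
  assumes "q \<noteq> 0" "r \<noteq> 0" "quantum_pair_III smul q r U V"
  shows "quantum_pair_III smul (q powi (n\<^sup>2)) (r powi n) (matrix_powi U n) (matrix_powi V n)"
  using assms twisted_commute_powi_powi[of U U 1 r n n] twisted_commute_powi_powi[of V V 1 r n n]
    twisted_commute_powi_powi[of U V q 1 n n] twisted_commute_powi_powi[of V U "inverse q" 1 n n]
  by (simp add: quantum_pair_III_iff upper_triangular_unit_matrix_powi power_int_inverse power2_eq_square)

text \<open>
  Biadditivity of the exponent: of the four pairings of the factors, \<open>U\<close> with \<open>U\<close> and \<open>V\<close> with
  \<open>V\<close> contribute nothing, \<open>U\<^sup>n\<close> with \<open>V\<^sup>t\<close> contributes \<open>n t\<close>, and \<open>V\<^sup>m\<close> with \<open>U\<^sup>s\<close>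
  contributes \<open>- m s\<close>.
\<close>

lemma twisted_commute_monomials:
  assumes "q \<noteq> 0" "quantum_pair_II smul q U V"
  shows "twisted_commute (q powi (n * t - m * s)) 1
    (matrix_powi U n ** matrix_powi V m) (matrix_powi U s ** matrix_powi V t)"
proof -
  have UV: "upper_triangular_unit U" "upper_triangular_unit V"
    and tc: "twisted_commute 1 1 U U" "twisted_commute 1 1 V V"
      "twisted_commute q 1 U V" "twisted_commute (inverse q) 1 V U"
    using assms by (simp_all add: quantum_pair_II_iff_III quantum_pair_III_iff)
  note pow = UV[THEN upper_triangular_unit_matrix_powi]
  have "twisted_commute ((1 * q powi (n * t)) * (inverse q powi (m * s) * 1)) (1 * 1)
    (matrix_powi U n ** matrix_powi V m) (matrix_powi U s ** matrix_powi V t)"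
    using UV tc assms(1)
    by (intro twisted_commute_mult_left twisted_commute_mult_right pow)
      (use twisted_commute_powi_powi[where c = 1] twisted_commute_powi_powi[where a = 1 and c = 1]
        in fastforce)+
  moreover have "(1 * q powi (n * t)) * (inverse q powi (m * s) * 1) = q powi (n * t - m * s)"
    using assms(1) by (simp add: power_int_diff power_int_inverse divide_inverse)
  ultimately show ?thesis by simp
qed

text \<open>
  All four conditions of the characterisation are instances of \<open>twisted_commute_monomials\<close>; for
  a monomial against itself the exponent is \<open>n m - m n = 0\<close>.
\<close>

lemma quantum_pair_II_monomials:
  assumes "q \<noteq> 0" "quantum_pair_II smul q U V"
  shows "quantum_pair_II smul (q powi (n * t - m * s))
    (matrix_powi U n ** matrix_powi V m) (matrix_powi U s ** matrix_powi V t)"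
proof -
  have UV: "upper_triangular_unit U" "upper_triangular_unit V"
    using assms(2) by (simp_all add: quantum_pair_II_def)
  have "q powi (s * m - t * n) = inverse (q powi (n * t - m * s))"
    by (simp add: power_int_minus[symmetric] mult.commute)
  then show ?thesis
    using assms(1) UV twisted_commute_monomials[OF assms, of n t m s] twisted_commute_monomials[OF assms, of s m t n]
      twisted_commute_monomials[OF assms, of n m m n] twisted_commute_monomials[OF assms, of s t t s]
    by (simp add: quantum_pair_II_iff_III quantum_pair_III_iff upper_triangular_unit_mult
        upper_triangular_unit_matrix_powi mult.commute)
qed

lemma quantum_pair_II_scale:
  assumes "q \<noteq> 0" "k \<noteq> 0" "l \<noteq> 0" "quantum_pair_II smul q U V"
  shows "quantum_pair_II smul q (map_matrix (smul k) U) (map_matrix (smul l) V)"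
proof -
  have unit: "two_sided_unit (smul j x)" if x: "two_sided_unit x" and j: "j \<noteq> 0" for j x
  proof -
    obtain y where "x * y = 1" "y * x = 1" using x unfolding two_sided_unit_def by blast
    then show ?thesis
      unfolding two_sided_unit_def using j
      by (intro exI[of _ "smul (inverse j) y"]) (simp add: smul_mult_left smul_mult_right)
  qed
  then have "upper_triangular_unit (map_matrix (smul j) X)"
    if "upper_triangular_unit X" "j \<noteq> 0" for j X
    using that by (simp add: upper_triangular_unit_def map_matrix_def)
  then show ?thesis
    using assms by (auto simp: quantum_pair_II_iff_III quantum_pair_III_iff intro: twisted_commute_scale)
qed


section \<open>Normalising the diagonal of a monomial\<close>

text \<open>
  The product is \<open>\<alpha>\<^sub>X \<alpha>\<^sub>Y \<gamma>\<^sub>X \<gamma>\<^sub>Y\<close>; exchanging the two inner factors costs \<open>a\<close> and lets both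
  diagonals cancel.
\<close>

lemma alpha_gamma_mult:
  assumes "upper_triangular_unit X" "upper_triangular_unit Y"
    and "alpha X * gamma X = 1" "alpha Y * gamma Y = 1"
    and "alpha Y * gamma X = smul a (gamma X * alpha Y)"
  shows "alpha (X ** Y) * gamma (X ** Y) = smul a 1"
proof -
  have "alpha (X ** Y) * gamma (X ** Y) = alpha X * (alpha Y * gamma X) * gamma Y"
    using assms(1,2) by (simp add: matrix_mult_2_entries upper_triangular_unit_def mult.assoc)
  also have "\<dots> = smul a ((alpha X * gamma X) * (alpha Y * gamma Y))"
    by (simp add: assms(5) smul_mult_left smul_mult_right mult.assoc)
  finally show ?thesis using assms(3,4) by simp
qed

text \<open>
  In each step of the induction \<open>alpha_gamma_mult\<close> applies with \<open>a = 1\<close>, since \<open>\<alpha>\<close> of a power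
  of \<open>U\<close> commutes with \<open>\<gamma>\<close> of \<open>U\<close> and of its inverse. This commutation is carried
  along in the induction.
\<close>

lemma alpha_gamma_matrix_powi:
  assumes U: "upper_triangular_unit U" "ID1 U" and tc: "twisted_commute 1 1 U U"
  shows "alpha (matrix_powi U n) * gamma (matrix_powi U n) = 1"
proof -
  note inv = upper_triangular_unit_matrix_inv[OF U(1)]
  have "alpha (matrix_inv U) = alpha (matrix_inv U) * (alpha U * gamma U)"
    using U(2) by (simp add: ID1_def)
  also have "\<dots> = gamma U"
    by (simp add: mult.assoc[symmetric] inv(3))
  finally have ag_inv: "alpha (matrix_inv U) * gamma (matrix_inv U) = 1"
    by (simp add: inv(4))
  have tc_inv: "twisted_commute 1 1 (matrix_inv U) U"
    using twisted_commute_inv_left[OF U(1) _ _ tc] by simp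
  have "upper_triangular_unit (matrix_powi U n) \<and> twisted_commute 1 1 (matrix_powi U n) U \<and>
      alpha (matrix_powi U n) * gamma (matrix_powi U n) = 1"
  proof (rule matrix_powi_induct)
    fix Y
    assume Y: "upper_triangular_unit Y \<and> twisted_commute 1 1 Y U \<and> alpha Y * gamma Y = 1"
    then have YU: "alpha Y * gamma U = smul 1 (gamma U * alpha Y)"
      by (simp add: twisted_commute_def)
    have YU_inv: "alpha Y * gamma (matrix_inv U) = smul 1 (gamma (matrix_inv U) * alpha Y)"
      using twisted_commute_inv_right[OF U(1) _ conjunct1[OF conjunct2[OF Y]]]
      by (simp add: twisted_commute_def)
    show "upper_triangular_unit (U ** Y) \<and> twisted_commute 1 1 (U ** Y) U \<and>
        alpha (U ** Y) * gamma (U ** Y) = 1"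
      using U Y tc alpha_gamma_mult[OF U(1) _ _ _ YU] twisted_commute_mult_left[OF U(1) _ tc, of Y 1 1]
      by (simp add: ID1_def upper_triangular_unit_mult)
    show "upper_triangular_unit (matrix_inv U ** Y) \<and> twisted_commute 1 1 (matrix_inv U ** Y) U \<and>
        alpha (matrix_inv U ** Y) * gamma (matrix_inv U ** Y) = 1"
      using Y inv(1) ag_inv alpha_gamma_mult[OF inv(1) _ _ _ YU_inv]
        twisted_commute_mult_left[OF inv(1) _ tc_inv, of Y 1 1]
      by (simp add: upper_triangular_unit_mult)
  qed (simp add: upper_triangular_unit_mat_1 twisted_commute_mat_1_left, simp add: mat_def)
  then show ?thesis by blast
qed

text \<open>
  By \<open>alpha_gamma_mult\<close> the diagonal of \<open>U\<^sup>e V\<^sup>f\<close> has product \<open>q\<^sup>e\<^sup>f\<close>: the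
  inner exchange moves \<open>\<alpha>\<close> of \<open>V\<^sup>f\<close> past \<open>\<gamma>\<close> of \<open>U\<^sup>e\<close>. Only the squares of the scaling
  factors matter, so no choice of a square root of \<open>q\<close> enters here.
\<close>

lemma quantum_pair_I_monomials:
  assumes "q \<noteq> 0" "quantum_pair_I smul q U V"
    and "k * k = q powi (- (n * m))" "l * l = q powi (- (s * t))"
  shows "quantum_pair_I smul (q powi (n * t - m * s))
    (map_matrix (smul k) (matrix_powi U n ** matrix_powi V m))
    (map_matrix (smul l) (matrix_powi U s ** matrix_powi V t))"
proof -
  have II: "quantum_pair_II smul q U V" and "ID1 U" "ID1 V"
    using assms(1,2) by (simp_all add: quantum_pair_I_iff_II)
  then have UV: "upper_triangular_unit U" "upper_triangular_unit V"
    and tc: "twisted_commute 1 1 U U" "twisted_commute 1 1 V V" "twisted_commute (inverse q) 1 V U"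
    using assms(1) by (simp_all add: quantum_pair_II_iff_III quantum_pair_III_iff)
  have ID1: "ID1 (map_matrix (smul j) (matrix_powi U e ** matrix_powi V f))"
    if j: "j * j = q powi (- (e * f))" for j e f
  proof -
    let ?W = "matrix_powi U e ** matrix_powi V f"
    have "twisted_commute (inverse q powi (f * e)) 1 (matrix_powi V f) (matrix_powi U e)"
      using twisted_commute_powi_powi[OF UV(2,1) _ _ tc(3), of f e] assms(1) by simp
    then have "alpha (matrix_powi V f) * gamma (matrix_powi U e) =
        smul (q powi (e * f)) (gamma (matrix_powi U e) * alpha (matrix_powi V f))"
      by (simp add: twisted_commute_def power_int_inverse mult.commute)
    then have "alpha ?W * gamma ?W = smul (q powi (e * f)) 1"
      using UV tc \<open>ID1 U\<close> \<open>ID1 V\<close>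
      by (intro alpha_gamma_mult upper_triangular_unit_matrix_powi alpha_gamma_matrix_powi)
    moreover have "gamma ?W * alpha ?W = alpha ?W * gamma ?W"
      using quantum_pair_II_monomials[OF assms(1) II, of e f f e]
      by (simp add: quantum_pair_II_def ID2_def)
    moreover have "j * (j * q powi (e * f)) = 1"
      using assms(1) by (simp add: mult.assoc[symmetric] j power_int_minus)
    ultimately show ?thesis
      by (simp add: ID1_def map_matrix_def smul_mult_left smul_mult_right)
  qed
  have "k \<noteq> 0" "l \<noteq> 0"
    using assms(1,3,4) by (auto dest: sym)
  then show ?thesis
    using assms ID1 quantum_pair_II_scale[OF _ _ _ quantum_pair_II_monomials[OF assms(1) II]]
    by (simp add: quantum_pair_I_iff_II)
qed

end

lemma half_powi_square:
  assumes "q \<noteq> 0" "odd e \<Longrightarrow> h ^ 2 = q"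
  shows "half_powi q h e * half_powi q h e = q powi e"
proof (cases "even e")
  case True
  have "q powi (e div 2) * q powi (e div 2) = q powi (e div 2 + e div 2)"
    by (rule power_int_add[symmetric]) (simp add: assms(1))
  also have "e div 2 + e div 2 = e" using True by presburger
  finally show ?thesis using True by (simp add: half_powi_def)
next
  case False
  then show ?thesis
    using assms by (auto simp: half_powi_def power2_eq_square power_int_mult_distrib)
qed

theorem theorem2:
  fixes smul :: "'k::field \<Rightarrow> 'a::ring_1 \<Rightarrow> 'a" and q r :: 'k
  assumes "k_algebra smul"
    and "q \<noteq> 0" and "q \<noteq> 1" and "r \<noteq> 0" and "r \<noteq> 1"
  shows
    "(\<forall>U\<^sub>1 U\<^sub>2 :: 'a^2^2. quantum_pair_I smul q U\<^sub>1 U\<^sub>2 \<longrightarrow>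
        (\<forall>(n::int) (m::int) (s::int) (t::int) (h::'k).
          (odd (n * m) \<or> odd (s * t) \<longrightarrow> h ^ 2 = q) \<longrightarrow>
          quantum_pair_I smul (q powi (n * t - m * s))
            (map_matrix (smul (half_powi q h (- (n * m))))
              (matrix_powi U\<^sub>1 n ** matrix_powi U\<^sub>2 m))
            (map_matrix (smul (half_powi q h (- (s * t))))
              (matrix_powi U\<^sub>1 s ** matrix_powi U\<^sub>2 t))))
     \<and>
     (\<forall>U\<^sub>1 U\<^sub>2 :: 'a^2^2. quantum_pair_II smul q U\<^sub>1 U\<^sub>2 \<longrightarrow>
        (\<forall>(n::int) (m::int) (s::int) (t::int).
          quantum_pair_II smul (q powi (n * t - m * s))
            (matrix_powi U\<^sub>1 n ** matrix_powi U\<^sub>2 m)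
            (matrix_powi U\<^sub>1 s ** matrix_powi U\<^sub>2 t)))
     \<and>
     (\<forall>U\<^sub>1 U\<^sub>2 :: 'a^2^2. quantum_pair_III smul q r U\<^sub>1 U\<^sub>2 \<longrightarrow>
        (\<forall>n::int.
          quantum_pair_III smul (q powi (n ^ 2)) (r powi n)
            (matrix_powi U\<^sub>1 n) (matrix_powi U\<^sub>2 n)))"
proof -
  interpret k_algebra smul by fact
  show ?thesis
    using assms(2,4)
    by (intro conjI allI impI quantum_pair_I_monomials quantum_pair_II_monomials
        quantum_pair_III_powi half_powi_square) auto
qed

end
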